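(* An $\mathcal{F}$-system $\langle S,F\rangle$ is paradoxical if and only if it does not have any conglomerate.
   Context: An $\mathcal{F}$-system is a pair $\langle S, F\rangle$ where $S$ is a set (its elements are called sentences) and $F\subseteq S\times S$ is a binary relation. For $x\in S$ put $\overrightarrow{F}(x)=\{y\in S: (x,y)\in F\}$ and $\overleftarrow{F}(x)=\{y\in S:(y,x)\in F\}$; for $A\subseteq S$ put $\overrightarrow{F}(A)=\bigcup_{x\in A}\overrightarrow{F}(x)$ and $\overleftarrow{F}(A)=\bigcup_{x\in A}\overleftarrow{F}(x)$. A sentence $x$ is a sink if $\overrightarrow{F}(x)=\emptyset$, and $sinks(A)=\{x\in A: x\text{ is a sink}\}$. A labelling on $\langle S,F\rangle$ is a total function $L:S\to\{\mathtt{T},\mathtt{F},\mathtt{U}\}$ (three distinct labels) such that for all $x\in S\setminus sinks(S)$: (a) $L(x)=\mathtt{F}$ iff $L(z)=\mathtt{T}$ for some $z\in\overrightarrow{F}(x)$; and (b) $L(x)=\mathtt{T}$ iff $L(z)=\mathtt{F}$ for every $z\in\overrightarrow{F}(x)$. (Labels of sinks are unrestricted.) A labelling $L$ is classical iff $L(x)\neq\mathtt{U}$ for every $x\in S$. An $\mathcal{F}$-system is paradoxical iff it has no classical labellings. A conglomerate of $\langle S,F\rangle$ is a subset $A\subseteq S$ such that (1) $\overleftarrow{F}(A)\subseteq S\setminus A$, and (2) $(S\setminus A)\setminus sinks(S)\subseteq\overleftarrow{F}(A)$. *)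

theory Defs
  imports Main
begin

definition F_system :: "'a set \<Rightarrow> ('a \<times> 'a) set \<Rightarrow> bool" where
  "F_system S F \<longleftrightarrow> F \<subseteq> S \<times> S"

definition out_nbrs :: "'a set \<Rightarrow> ('a \<times> 'a) set \<Rightarrow> 'a \<Rightarrow> 'a set" where
  "out_nbrs S F x = {y \<in> S. (x, y) \<in> F}"

definition in_nbrs :: "'a set \<Rightarrow> ('a \<times> 'a) set \<Rightarrow> 'a \<Rightarrow> 'a set" where
  "in_nbrs S F x = {y \<in> S. (y, x) \<in> F}"

definition in_nbrs_set :: "'a set \<Rightarrow> ('a \<times> 'a) set \<Rightarrow> 'a set \<Rightarrow> 'a set" where
  "in_nbrs_set S F A = (\<Union>x\<in>A. in_nbrs S F x)"

definition sinks :: "'a set \<Rightarrow> ('a \<times> 'a) set \<Rightarrow> 'a set \<Rightarrow> 'a set" where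
  "sinks S F A = {x \<in> A. out_nbrs S F x = {}}"

datatype label = Lab_T | Lab_F | Lab_U

text \<open>A labelling of \<open>S\<close> is represented by a function on the whole type; the conditions below
  only concern its values on \<open>S\<close>, so the values outside \<open>S\<close> are irrelevant.\<close>

definition labelling :: "'a set \<Rightarrow> ('a \<times> 'a) set \<Rightarrow> ('a \<Rightarrow> label) \<Rightarrow> bool" where
  "labelling S F L \<longleftrightarrow>
     (\<forall>x \<in> S - sinks S F S.
        (L x = Lab_F \<longleftrightarrow> (\<exists>z \<in> out_nbrs S F x. L z = Lab_T)) \<and>
        (L x = Lab_T \<longleftrightarrow> (\<forall>z \<in> out_nbrs S F x. L z = Lab_F)))"

definition classical_labelling :: "'a set \<Rightarrow> ('a \<times> 'a) set \<Rightarrow> ('a \<Rightarrow> label) \<Rightarrow> bool" where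
  "classical_labelling S F L \<longleftrightarrow> labelling S F L \<and> (\<forall>x \<in> S. L x \<noteq> Lab_U)"

definition paradoxical :: "'a set \<Rightarrow> ('a \<times> 'a) set \<Rightarrow> bool" where
  "paradoxical S F \<longleftrightarrow> \<not> (\<exists>L. classical_labelling S F L)"

definition conglomerate :: "'a set \<Rightarrow> ('a \<times> 'a) set \<Rightarrow> 'a set \<Rightarrow> bool" where
  "conglomerate S F A \<longleftrightarrow>
     A \<subseteq> S \<and>
     in_nbrs_set S F A \<subseteq> S - A \<and>
     (S - A) - sinks S F S \<subseteq> in_nbrs_set S F A"

end

theory Submission
  imports Defs
begin

text \<open>Conglomerates are the sets of true sentences of classical labellings. Without
  \<open>Lab_U\<close>, a labelling is fixed by its true set, and both labelling clauses say that a
  non-sink is true iff none of its out-neighbours is. The two inclusions in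
  \<open>conglomerate\<close> are the two halves of this equivalence for \<open>A\<close>; sinks are
  free on both sides.\<close>

lemma conglomerate_true_set:
  assumes "classical_labelling S F L"
  shows "conglomerate S F {x \<in> S. L x = Lab_T}"
proof -
  have F: "L x = Lab_F \<longleftrightarrow> (\<exists>z \<in> out_nbrs S F x. L z = Lab_T)"
    if "x \<in> S" "out_nbrs S F x \<noteq> {}" for x
    using assms that unfolding classical_labelling_def labelling_def sinks_def by blast
  have two_valued: "L x = Lab_T \<or> L x = Lab_F" if "x \<in> S" for x
    using assms that by (cases "L x") (auto simp: classical_labelling_def)
  have "L x \<noteq> Lab_T" if "x \<in> S" "y \<in> S" "(x, y) \<in> F" "L y = Lab_T" for x y
  proof -
    \<comment> \<open>The edge itself shows that \<open>x\<close> is not a sink, so \<open>F\<close>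
      applies.\<close>
    have "y \<in> out_nbrs S F x" using that by (simp add: out_nbrs_def)
    with F[of x] that have "L x = Lab_F" by blast
    then show ?thesis by simp
  qed
  \<comment> \<open>Classicality enters here: not true means false, and a false non-sink has a true
    out-neighbour.\<close>
  moreover have "\<exists>y \<in> S. (x, y) \<in> F \<and> L y = Lab_T"
    if "x \<in> S" "L x \<noteq> Lab_T" "out_nbrs S F x \<noteq> {}" for x
    using F[of x] two_valued[of x] that unfolding out_nbrs_def by blast
  ultimately show ?thesis
    unfolding conglomerate_def in_nbrs_set_def in_nbrs_def sinks_def by blast
qed

lemma classical_labelling_of_conglomerate:
  assumes "conglomerate S F A"
  shows "classical_labelling S F (\<lambda>x. if x \<in> A then Lab_T else Lab_F)"
proof -
  \<comment> \<open>Left to right is the independence of \<open>A\<close>; right to left is the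
    contrapositive of the covering of non-sinks outside \<open>A\<close>.\<close>
  have "x \<in> A \<longleftrightarrow> (\<forall>z \<in> out_nbrs S F x. z \<notin> A)"
    if "x \<in> S - sinks S F S" for x
    using assms that
    unfolding conglomerate_def in_nbrs_set_def in_nbrs_def out_nbrs_def by blast
  \<comment> \<open>With labels read as membership in \<open>A\<close>, one labelling clause is the
    equivalence above and the other its negation.\<close>
  moreover have "(if x \<in> A then Lab_T else Lab_F) = Lab_T \<longleftrightarrow> x \<in> A"
    "(if x \<in> A then Lab_T else Lab_F) = Lab_F \<longleftrightarrow> x \<notin> A"
    "(if x \<in> A then Lab_T else Lab_F) \<noteq> Lab_U" for x
    by simp_all
  ultimately show ?thesis
    unfolding classical_labelling_def labelling_def by meson
qed

theorem corollary1:
  fixes S :: "'a set" and F :: "('a \<times> 'a) set"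
  assumes "F_system S F"
  shows "paradoxical S F \<longleftrightarrow> \<not> (\<exists>A. conglomerate S F A)"
  unfolding paradoxical_def
  using conglomerate_true_set classical_labelling_of_conglomerate by blast

end
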